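(* Let $G$ be a graph with a universal vertex $v$. If $\overline{\operatorname{Z}}(G)=\operatorname{Z}(G)$, then $\overline{\operatorname{Z}}(G-v)=\operatorname{Z}(G-v)$.
   Context: All graphs are finite, simple and undirected. A universal vertex is a vertex adjacent to all other vertices; $G-v$ is the graph obtained by deleting $v$. Given a set $S$ of initially blue vertices (all others white), the zero forcing color change rule says that a blue vertex with exactly one white neighbor causes that neighbor to become blue. $S$ is a zero forcing set if repeatedly applying this rule eventually makes every vertex blue. $\operatorname{Z}(G)$ is the minimum cardinality of a zero forcing set of $G$. A minimal zero forcing set is a zero forcing set containing no other zero forcing set as a proper subset, and $\overline{\operatorname{Z}}(G)$ is the maximum size of a minimal zero forcing set of $G$. *)

theory Defs
  imports "Graph_Theory.Digraph"
begin

text \<open>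
  Finite simple undirected graphs are those satisfying the locale predicate \<^const>\<open>graph\<close>
  (finite, symmetric, no loops, no parallel arcs), with adjacency
  \<open>u \<rightarrow>\<^bsub>G\<^esub> w\<close>. The graph without vertices is allowed, so that
  deleting the vertex of a one-vertex graph makes sense.
\<close>

definition universal_vertex :: "('a, 'b) pre_digraph \<Rightarrow> 'a \<Rightarrow> bool" where
  "universal_vertex G v \<longleftrightarrow> v \<in> verts G \<and> (\<forall>u \<in> verts G - {v}. v \<rightarrow>\<^bsub>G\<^esub> u)"

definition white_neighbors :: "('a, 'b) pre_digraph \<Rightarrow> 'a set \<Rightarrow> 'a \<Rightarrow> 'a set" where
  "white_neighbors G B u = {w \<in> verts G - B. u \<rightarrow>\<^bsub>G\<^esub> w}"

text \<open>One application of the color change rule to the set \<open>B\<close> of blue vertices.\<close>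

inductive color_change :: "('a, 'b) pre_digraph \<Rightarrow> 'a set \<Rightarrow> 'a set \<Rightarrow> bool"
  for G :: "('a, 'b) pre_digraph" where
  force: "u \<in> B \<Longrightarrow> white_neighbors G B u = {w} \<Longrightarrow> color_change G B (insert w B)"

definition zero_forcing_set :: "('a, 'b) pre_digraph \<Rightarrow> 'a set \<Rightarrow> bool" where
  "zero_forcing_set G S \<longleftrightarrow> S \<subseteq> verts G \<and> (color_change G)\<^sup>*\<^sup>* S (verts G)"

definition minimal_zero_forcing_set :: "('a, 'b) pre_digraph \<Rightarrow> 'a set \<Rightarrow> bool" where
  "minimal_zero_forcing_set G S \<longleftrightarrow>
     zero_forcing_set G S \<and> (\<forall>T. T \<subset> S \<longrightarrow> \<not> zero_forcing_set G T)"

definition zero_forcing_number :: "('a, 'b) pre_digraph \<Rightarrow> nat" where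
  "zero_forcing_number G = Min (card ` {S. zero_forcing_set G S})"

definition upper_zero_forcing_number :: "('a, 'b) pre_digraph \<Rightarrow> nat" where
  "upper_zero_forcing_number G = Max (card ` {S. minimal_zero_forcing_set G S})"

text \<open>The minimum and the maximum range over finite nonempty sets.\<close>

lemma zero_forcing_set_verts: "zero_forcing_set G (verts G)"
  by (simp add: zero_forcing_set_def)

lemma finite_zero_forcing_sets:
  assumes "finite (verts G)"
  shows "finite {S. zero_forcing_set G S}"
  by (rule finite_subset[of _ "Pow (verts G)"]) (auto simp: zero_forcing_set_def assms)

lemma finite_minimal_zero_forcing_sets:
  assumes "finite (verts G)"
  shows "finite {S. minimal_zero_forcing_set G S}"
  by (rule finite_subset[OF _ finite_zero_forcing_sets[OF assms]])
     (auto simp: minimal_zero_forcing_set_def)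

lemma ex_minimal_zero_forcing_set:
  assumes "finite (verts G)"
  shows "\<exists>S. minimal_zero_forcing_set G S"
proof -
  have "{S. zero_forcing_set G S} \<noteq> {}"
    using zero_forcing_set_verts by auto
  from finite_has_minimal[OF finite_zero_forcing_sets[OF assms] this]
  show ?thesis
    unfolding minimal_zero_forcing_set_def by auto
qed

end

theory Submission
  imports Defs
begin

text \<open>
  Let \<open>H = G - v\<close>. As long as \<open>v\<close> is white it is the only vertex that can be forced, and once it is
  blue it can only force the very last white vertex. If that last vertex has a neighbour in \<open>H\<close>, this
  neighbour can force it instead; so \<open>v\<close> is of use only for forcing one isolated vertex of \<open>H\<close>.
  Hence, for a minimal zero forcing set \<open>S\<close> of \<open>H\<close>, a minimal zero forcing set of \<open>G\<close> is

  \<^item> \<open>S \<union> {v}\<close> if \<open>H\<close> has no isolated vertex,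
  \<^item> \<open>(S - {w}) \<union> {v}\<close> if \<open>w\<close> is the only isolated vertex of \<open>H\<close>,
  \<^item> \<open>S - {w}\<close> if \<open>w\<close> is one of several isolated vertices of \<open>H\<close>.

  In each case the cardinality changes by a constant that does not depend on \<open>S\<close>.
\<close>

section \<open>Extremal zero forcing sets and comparison of two graphs\<close>

lemma zero_forcing_number_le:
  assumes "finite (verts G)" "zero_forcing_set G S"
  shows "zero_forcing_number G \<le> card S"
  unfolding zero_forcing_number_def
  using assms finite_zero_forcing_sets[OF assms(1)] by (intro Min_le) auto

lemma zero_forcing_number_attained:
  assumes "finite (verts G)"
  obtains S where "zero_forcing_set G S" "card S = zero_forcing_number G"
proof -
  have "zero_forcing_number G \<in> card ` {S. zero_forcing_set G S}"
    unfolding zero_forcing_number_def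
    using finite_zero_forcing_sets[OF assms] zero_forcing_set_verts by (intro Min_in) auto
  then show thesis using that by auto
qed

lemma upper_zero_forcing_number_ge:
  assumes "finite (verts G)" "minimal_zero_forcing_set G S"
  shows "card S \<le> upper_zero_forcing_number G"
  unfolding upper_zero_forcing_number_def
  using assms finite_minimal_zero_forcing_sets[OF assms(1)] by (intro Max_ge) auto

lemma upper_zero_forcing_number_attained:
  assumes "finite (verts G)"
  obtains S where "minimal_zero_forcing_set G S" "card S = upper_zero_forcing_number G"
proof -
  have "upper_zero_forcing_number G \<in> card ` {S. minimal_zero_forcing_set G S}"
    unfolding upper_zero_forcing_number_def
    using finite_minimal_zero_forcing_sets[OF assms] ex_minimal_zero_forcing_set[OF assms]
    by (intro Max_in) auto
  then show thesis using that by auto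
qed

text \<open>Apply \<open>f\<close> to a largest minimal set and to a smallest zero forcing set of
  \<open>H\<close>: by \<open>eq\<close> the first image is no larger than the second, and the
  constant shift in size cancels. The shift is split into \<open>a\<close> and \<open>b\<close>
  because it may go either way and subtraction on \<open>nat\<close> truncates.\<close>

lemma upper_eq_zero_forcing_number_transfer:
  assumes fin: "finite (verts G)" "finite (verts H)"
    and eq: "upper_zero_forcing_number G = zero_forcing_number G"
    and zfs: "\<And>S. zero_forcing_set H S \<Longrightarrow> zero_forcing_set G (f S)"
    and min: "\<And>S. minimal_zero_forcing_set H S \<Longrightarrow> minimal_zero_forcing_set G (f S)"
    and card: "\<And>S. zero_forcing_set H S \<Longrightarrow> card (f S) + a = card S + b"
  shows "upper_zero_forcing_number H = zero_forcing_number H"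
proof -
  obtain S where S: "minimal_zero_forcing_set H S" "card S = upper_zero_forcing_number H"
    using upper_zero_forcing_number_attained fin(2) by blast
  then have S': "zero_forcing_set H S" by (simp add: minimal_zero_forcing_set_def)
  obtain S0 where S0: "zero_forcing_set H S0" "card S0 = zero_forcing_number H"
    using zero_forcing_number_attained fin(2) by blast
  have "card (f S) \<le> card (f S0)"
    using upper_zero_forcing_number_ge[OF fin(1) min[OF S(1)]]
      zero_forcing_number_le[OF fin(1) zfs[OF S0(1)]] eq by linarith
  then have "card S \<le> card S0" using card[OF S'] card[OF S0(1)] by linarith
  with S(2) S0(2) zero_forcing_number_le[OF fin(2) S'] show ?thesis by linarith
qed

section \<open>Neighbourhoods after deletion of a universal vertex\<close>

locale graph_with_universal_vertex = graph G for G :: "('a, 'b) pre_digraph" +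
  fixes v :: 'a
  assumes universal: "universal_vertex G v"
begin

abbreviation "H \<equiv> del_vert v"

text \<open>In \<open>G\<close> these vertices are exactly the leaves attached to
  \<open>v\<close>.\<close>

definition isolated :: "'a \<Rightarrow> bool" where
  "isolated w \<longleftrightarrow> w \<in> verts H \<and> (\<forall>u. \<not> u \<rightarrow>\<^bsub>H\<^esub> w)"

lemma v_in_verts: "v \<in> verts G"
  using universal by (simp add: universal_vertex_def)

lemma verts_H: "verts H = verts G - {v}"
  by (simp add: verts_del_vert)

lemma finite_verts_H: "finite (verts H)"
  by (simp add: verts_H)

lemma adj_H_iff: "x \<rightarrow>\<^bsub>H\<^esub> y \<longleftrightarrow> x \<rightarrow>\<^bsub>G\<^esub> y \<and> x \<noteq> v \<and> y \<noteq> v"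
  by (auto simp: arcs_ends_def arc_to_ends_def arcs_del_vert tail_del_vert head_del_vert)

lemma adj_sym: "x \<rightarrow>\<^bsub>G\<^esub> y \<Longrightarrow> y \<rightarrow>\<^bsub>G\<^esub> x"
  using sym_arcs by (simp add: symmetric_def symD)

lemma adj_H_sym: "x \<rightarrow>\<^bsub>H\<^esub> y \<Longrightarrow> y \<rightarrow>\<^bsub>H\<^esub> x"
  by (simp add: adj_H_iff adj_sym)

lemma adj_universal: "x \<in> verts G \<Longrightarrow> x \<noteq> v \<Longrightarrow> x \<rightarrow>\<^bsub>G\<^esub> v"
  using universal adj_sym by (auto simp: universal_vertex_def)

lemma white_neighbors_universal:
  "v \<in> B \<Longrightarrow> white_neighbors G B v = verts G - B"
  using universal by (auto simp: white_neighbors_def universal_vertex_def)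

lemma white_neighbors_H:
  "u \<noteq> v \<Longrightarrow> white_neighbors H B u = white_neighbors G (insert v B) u"
  by (auto simp: white_neighbors_def verts_H adj_H_iff)

text \<open>An isolated vertex lies in no neighbourhood of \<open>H\<close>, so its colour does not
  influence any other vertex.\<close>

lemma white_neighbors_isolated_cong:
  assumes "\<And>w. w \<in> W \<Longrightarrow> isolated w"
  shows "white_neighbors H (B - W) u = white_neighbors H B u"
    and "white_neighbors H (B \<union> W) u = white_neighbors H B u"
  using assms by (auto simp: white_neighbors_def isolated_def)

section \<open>Forcing in \<open>H\<close> and forcing in \<open>G\<close>\<close>

lemma color_change_H_imp_G:
  assumes iso: "\<And>w. w \<in> W \<Longrightarrow> isolated w"
    and step: "color_change H B B'"
  shows "color_change G (insert v (B - W)) (insert v (B' - W))"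
  using step
proof cases
  case (force u w)
  have w: "u \<rightarrow>\<^bsub>H\<^esub> w" "w \<in> verts H" using force(3) by (auto simp: white_neighbors_def)
  \<comment> \<open>\<open>u\<close> and \<open>w\<close> are adjacent in \<open>H\<close>, so
    neither is isolated and the force is unaffected by whitening \<open>W\<close>.\<close>
  then have "u \<noteq> v" "w \<notin> W" "u \<notin> W"
    using iso adj_H_sym by (auto simp: adj_H_iff isolated_def)
  have "white_neighbors G (insert v (B - W)) u = {w}"
    using white_neighbors_H[OF \<open>u \<noteq> v\<close>, of "B - W"] force(3)
    by (simp add: white_neighbors_isolated_cong(1)[OF iso])
  moreover have "u \<in> insert v (B - W)" using force(2) \<open>u \<notin> W\<close> by auto
  moreover have "insert v (B' - W) = insert w (insert v (B - W))"
    using force(1) \<open>w \<notin> W\<close> by auto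
  ultimately show ?thesis by (simp add: color_change.force)
qed

lemma color_changes_H_imp_G:
  assumes "\<And>w. w \<in> W \<Longrightarrow> isolated w"
    and "(color_change H)\<^sup>*\<^sup>* B B'"
  shows "(color_change G)\<^sup>*\<^sup>* (insert v (B - W)) (insert v (B' - W))"
  using assms(2)
proof (induction rule: rtranclp_induct)
  case (step C D)
  with color_change_H_imp_G[OF assms(1)] show ?case by (meson rtranclp.rtrancl_into_rtrancl)
qed simp

text \<open>Being forced requires a neighbour, so a white isolated vertex stays white
  forever.\<close>

lemma isolated_in_zero_forcing_set:
  assumes "isolated w" "zero_forcing_set H S"
  shows "w \<in> S"
proof (rule ccontr)
  assume "w \<notin> S"
  have "(color_change H)\<^sup>*\<^sup>* S B \<Longrightarrow> w \<notin> B" for B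
  proof (induction rule: rtranclp_induct)
    case (step C D)
    from step(2) obtain u y where "white_neighbors H C u = {y}" "D = insert y C"
      by (auto elim: color_change.cases)
    moreover from this have "u \<rightarrow>\<^bsub>H\<^esub> y" by (auto simp: white_neighbors_def)
    ultimately show ?case using step(3) assms(1) by (auto simp: isolated_def)
  qed (rule \<open>w \<notin> S\<close>)
  with assms show False by (auto simp: zero_forcing_set_def isolated_def)
qed

definition removable :: "'a set \<Rightarrow> bool" where
  "removable W \<longleftrightarrow> W = {} \<and> (\<forall>w. \<not> isolated w) \<or> (\<exists>w. W = {w} \<and> isolated w)"

lemma removable_isolated: "removable W \<Longrightarrow> w \<in> W \<Longrightarrow> isolated w"
  by (auto simp: removable_def)

text \<open>The forces of \<open>H\<close> run in \<open>G\<close> with \<open>W\<close> left white;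
  at the end \<open>v\<close> forces the vertex of \<open>W\<close>, if there is one.\<close>

lemma zero_forcing_set_insert_universal:
  assumes W: "removable W" and S: "zero_forcing_set H S"
  shows "zero_forcing_set G (insert v (S - W))"
proof -
  have "(color_change G)\<^sup>*\<^sup>* (insert v (S - W)) (insert v (verts H - W))"
    using color_changes_H_imp_G removable_isolated[OF W] S
    unfolding zero_forcing_set_def by blast
  also have "(color_change G)\<^sup>*\<^sup>* (insert v (verts H - W)) (verts G)"
  proof (cases "W = {}")
    case True
    then have "insert v (verts H - W) = verts G" using v_in_verts by (auto simp: verts_H)
    then show ?thesis by simp
  next
    case False
    then obtain w where w: "W = {w}" "isolated w" using W by (auto simp: removable_def)
    then have "w \<in> verts G" "w \<noteq> v" by (auto simp: isolated_def verts_H)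
    then have "white_neighbors G (insert v (verts H - W)) v = {w}"
      using w by (subst white_neighbors_universal) (auto simp: verts_H)
    from color_change.force[OF _ this]
    have "color_change G (insert v (verts H - W)) (insert w (insert v (verts H - W)))" by simp
    moreover have "insert w (insert v (verts H - W)) = verts G"
      using w v_in_verts \<open>w \<in> verts G\<close> by (auto simp: verts_H)
    ultimately show ?thesis by auto
  qed
  finally show ?thesis using S v_in_verts by (auto simp: zero_forcing_set_def verts_H)
qed

lemma color_changes_G_imp_H:
  assumes "(color_change G)\<^sup>*\<^sup>* C (verts G)"
    and W: "removable W"
    and "v \<in> C" "C \<subseteq> verts G" "C \<inter> W = {}"
  shows "(color_change H)\<^sup>*\<^sup>* (C - {v} \<union> W) (verts H)"
  using assms(1,3-5)
proof (induction rule: converse_rtranclp_induct)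
  case base
  then have "W = {}" using removable_isolated[OF W] by (auto simp: isolated_def verts_H)
  then show ?case by (simp add: verts_H)
next
  case (step C C')
  from step(1) obtain u y where u: "u \<in> C" and wn: "white_neighbors G C u = {y}"
    and C': "C' = insert y C" by (auto elim: color_change.cases)
  have y: "y \<in> verts G" "y \<notin> C" "u \<rightarrow>\<^bsub>G\<^esub> y" using wn by (auto simp: white_neighbors_def)
  then have "y \<noteq> v" "y \<in> verts H" using step(4) by (auto simp: verts_H)
  have insv: "insert v (C - {v}) = C" using step(4) by auto
  show ?case
  proof (cases "y \<in> W")
    case True
    then have "W = {y}" "isolated y" using W by (auto simp: removable_def)
    \<comment> \<open>\<open>y\<close> has no neighbour but \<open>v\<close> in \<open>G\<close>, so
      \<open>v\<close> forces it, and \<open>v\<close> can do so only if \<open>y\<close> is the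
      last white vertex. With \<open>W\<close> blue nothing remains to be forced in
      \<open>H\<close>.\<close>
    then have "u = v" using y \<open>y \<noteq> v\<close> by (auto simp: isolated_def adj_H_iff)
    then have "verts G - C = {y}" using wn step(4) by (simp add: white_neighbors_universal)
    then have "C - {v} \<union> W = verts H"
      using \<open>W = {y}\<close> step(5) \<open>y \<in> verts H\<close> by (auto simp: verts_H)
    then show ?thesis by simp
  next
    case False
    have IH: "(color_change H)\<^sup>*\<^sup>* (C' - {v} \<union> W) (verts H)"
      using step(4-6) C' y(1) False by (intro step(3)) auto
    \<comment> \<open>Take \<open>u\<close> itself unless it is \<open>v\<close>. In that case
      \<open>y\<close> is the last white vertex, so \<open>W\<close> is empty, nothing is isolated,
      and any neighbour of \<open>y\<close> in \<open>H\<close> is blue with \<open>y\<close> as its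
      only white neighbour.\<close>
    have "\<exists>z \<in> C - {v}. white_neighbors H (C - {v}) z = {y}"
    proof (cases "u = v")
      case True
      then have rest: "verts G - C = {y}" using wn step(4) by (simp add: white_neighbors_universal)
      have "W \<subseteq> verts G - C"
        using removable_isolated[OF W] step(6) by (auto simp: isolated_def verts_H)
      then have "W = {}" using \<open>y \<notin> W\<close> by (auto simp: rest subset_singleton_iff)
      then have "\<not> isolated y" using W by (auto simp: removable_def)
      then obtain z where z: "z \<rightarrow>\<^bsub>H\<^esub> y" using \<open>y \<in> verts H\<close> by (auto simp: isolated_def)
      then have "z \<noteq> v" "z \<rightarrow>\<^bsub>G\<^esub> y" "z \<in> verts G" by (auto simp: adj_H_iff)
      moreover have "z \<noteq> y" using z adj_not_same by (auto simp: adj_H_iff)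
      ultimately have "z \<in> C - {v}" using rest by auto
      moreover have "white_neighbors H (C - {v}) z = {y}"
        unfolding white_neighbors_H[OF \<open>z \<noteq> v\<close>] insv unfolding white_neighbors_def rest
        using \<open>z \<rightarrow>\<^bsub>G\<^esub> y\<close> by auto
      ultimately show ?thesis by blast
    next
      case False
      then have "white_neighbors H (C - {v}) u = {y}"
        using wn white_neighbors_H[of u "C - {v}"] insv by metis
      with u False show ?thesis by blast
    qed
    then obtain z where "z \<in> C - {v} \<union> W" "white_neighbors H (C - {v} \<union> W) z = {y}"
      using white_neighbors_isolated_cong(2)[OF removable_isolated[OF W]] by auto
    then have "color_change H (C - {v} \<union> W) (insert y (C - {v} \<union> W))"
      by (rule color_change.force)
    moreover have "insert y (C - {v} \<union> W) = C' - {v} \<union> W" using C' \<open>y \<noteq> v\<close> by auto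
    ultimately show ?thesis using IH by (simp add: converse_rtranclp_into_rtranclp)
  qed
qed

lemma zero_forcing_set_H_of_G:
  assumes "zero_forcing_set G T" "removable W" "v \<in> T" "T \<inter> W = {}"
  shows "zero_forcing_set H (T - {v} \<union> W)"
  using assms color_changes_G_imp_H[of T W] removable_isolated[of W]
  by (auto simp: zero_forcing_set_def verts_H isolated_def)

text \<open>The first force must turn \<open>v\<close> blue, since \<open>v\<close> is a white
  neighbour of the forcing vertex \<open>u\<close>. All neighbours of \<open>u\<close> in
  \<open>H\<close> are then already blue; if there is one, it is redundant in \<open>H\<close>,
  where \<open>u\<close> can force it. This saved vertex \<open>x\<close> compensates for the
  absence of \<open>v\<close> from \<open>T\<close>.\<close>

lemma zero_forcing_set_without_universal:
  assumes T: "zero_forcing_set G T" and W: "removable W" and "v \<notin> T" "T \<inter> W = {}"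
  obtains u where "u \<in> T" "isolated u" "zero_forcing_set H (T \<union> W)"
  | x where "x \<in> T" "zero_forcing_set H (T - {x} \<union> W)"
proof -
  have sub: "T \<subseteq> verts G" "(color_change G)\<^sup>*\<^sup>* T (verts G)"
    using T by (auto simp: zero_forcing_set_def)
  \<comment> \<open>\<open>v\<close> is still white, so at least one force takes place.\<close>
  then obtain C where C: "color_change G T C" "(color_change G)\<^sup>*\<^sup>* C (verts G)"
    using v_in_verts \<open>v \<notin> T\<close> by (metis converse_rtranclpE)
  then obtain u y where u: "u \<in> T" and wn: "white_neighbors G T u = {y}" and "C = insert y T"
    by (auto elim: color_change.cases)
  have "u \<rightarrow>\<^bsub>G\<^esub> v" using adj_universal u sub \<open>v \<notin> T\<close> by blast
  then have "v \<in> white_neighbors G T u"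
    using v_in_verts \<open>v \<notin> T\<close> by (auto simp: white_neighbors_def)
  then have "y = v" using wn by auto
  have "zero_forcing_set G (insert v T)"
    using C \<open>C = insert y T\<close> \<open>y = v\<close> sub v_in_verts by (auto simp: zero_forcing_set_def)
  moreover have "insert v T \<inter> W = {}"
    using \<open>T \<inter> W = {}\<close> removable_isolated[OF W] by (auto simp: isolated_def verts_H)
  ultimately have TW: "zero_forcing_set H (T \<union> W)"
    using zero_forcing_set_H_of_G[of "insert v T" W] W \<open>v \<notin> T\<close> by simp
  show thesis
  proof (cases "isolated u")
    case True
    then show ?thesis using that(1) u TW by blast
  next
    case False
    then obtain x where x: "x \<rightarrow>\<^bsub>H\<^esub> u"
      using u sub \<open>v \<notin> T\<close> by (auto simp: isolated_def verts_H)
    then have ux: "u \<rightarrow>\<^bsub>H\<^esub> x" by (rule adj_H_sym)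
    then have "u \<rightarrow>\<^bsub>G\<^esub> x" "x \<in> verts H" "u \<noteq> v" "x \<noteq> v" by (auto simp: adj_H_iff verts_H)
    have "u \<noteq> x" using \<open>u \<rightarrow>\<^bsub>G\<^esub> x\<close> adj_not_same by auto
    have "x \<in> T"
      using wn \<open>y = v\<close> \<open>u \<rightarrow>\<^bsub>G\<^esub> x\<close> \<open>x \<in> verts H\<close> by (auto simp: white_neighbors_def verts_H)
    have "white_neighbors H T u = white_neighbors G T u - {v}"
      unfolding white_neighbors_H[OF \<open>u \<noteq> v\<close>] by (auto simp: white_neighbors_def)
    \<comment> \<open>The only white neighbour of \<open>u\<close> in \<open>G\<close> was
      \<open>v\<close>, so whitening \<open>x\<close> makes \<open>x\<close> its only white
      neighbour in \<open>H\<close>.\<close>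
    then have "white_neighbors H T u = {}" using wn \<open>y = v\<close> by simp
    then have "white_neighbors H (T - {x}) u = {x}"
      using ux \<open>x \<in> verts H\<close> by (auto simp: white_neighbors_def)
    then have "white_neighbors H (T - {x} \<union> W) u = {x}"
      using white_neighbors_isolated_cong(2)[OF removable_isolated[OF W]] by auto
    then have "color_change H (T - {x} \<union> W) (insert x (T - {x} \<union> W))"
      using u \<open>u \<noteq> x\<close> by (intro color_change.force) auto
    moreover have "insert x (T - {x} \<union> W) = T \<union> W" using \<open>x \<in> T\<close> by auto
    ultimately have "zero_forcing_set H (T - {x} \<union> W)"
      using TW by (auto simp: zero_forcing_set_def intro: converse_rtranclp_into_rtranclp)
    then show ?thesis using that(2) \<open>x \<in> T\<close> by blast
  qed
qed

section \<open>Minimal zero forcing sets of \<open>G\<close> obtained from those of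
  \<open>H\<close>\<close>

lemma removable_subset:
  "removable W \<Longrightarrow> zero_forcing_set H S \<Longrightarrow> W \<subseteq> S"
  using isolated_in_zero_forcing_set removable_isolated by blast

lemma v_notin_zero_forcing_set: "zero_forcing_set H S \<Longrightarrow> v \<notin> S"
  by (auto simp: zero_forcing_set_def verts_H)

text \<open>A smaller zero forcing set \<open>T\<close> of \<open>G\<close> yields a zero forcing
  set of \<open>H\<close> properly inside \<open>S\<close>. By \<open>only\<close>, no isolated
  vertex lies in \<open>T\<close>, which excludes a first force by an isolated vertex.\<close>

lemma minimal_zero_forcing_set_insert_universal:
  assumes W: "removable W" and only: "\<And>w. isolated w \<Longrightarrow> w \<in> W"
    and S: "minimal_zero_forcing_set H S"
  shows "minimal_zero_forcing_set G (insert v (S - W))"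
  unfolding minimal_zero_forcing_set_def
proof (intro conjI allI impI notI)
  have S': "zero_forcing_set H S" and least: "\<And>T. T \<subset> S \<Longrightarrow> \<not> zero_forcing_set H T"
    using S by (auto simp: minimal_zero_forcing_set_def)
  note WS = removable_subset[OF W S'] and vS = v_notin_zero_forcing_set[OF S']
  show "zero_forcing_set G (insert v (S - W))"
    by (rule zero_forcing_set_insert_universal[OF W S'])
  fix T assume T: "T \<subset> insert v (S - W)" and zT: "zero_forcing_set G T"
  have TW: "T \<inter> W = {}" using T WS vS by auto
  show False
  proof (cases "v \<in> T")
    case True
    have "T - {v} \<union> W \<subset> S" using T True WS vS TW by auto
    then show False using least zero_forcing_set_H_of_G[OF zT W True TW] by blast
  next
    case False
    from zT W False TW show False
    proof (cases rule: zero_forcing_set_without_universal)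
      case (1 u)
      then show False using only TW by auto
    next
      case (2 x)
      \<comment> \<open>Without \<open>v\<close>, \<open>T\<close> may be all of
        \<open>S - W\<close>; dropping \<open>x\<close> makes the inclusion strict.\<close>
      have "T - {x} \<union> W \<subset> S" using T 2(1) TW WS False by auto
      then show False using least 2(2) by blast
    qed
  qed
qed

text \<open>The second isolated vertex \<open>w'\<close> is blue and has \<open>v\<close> as its
  only neighbour in \<open>G\<close>, so it forces \<open>v\<close> at once; \<open>v\<close> need
  not be blue initially and later forces \<open>w\<close>.\<close>

lemma zero_forcing_set_remove_isolated:
  assumes w: "isolated w" and w': "isolated w'" "w' \<noteq> w" and S: "zero_forcing_set H S"
  shows "zero_forcing_set G (S - {w})"
proof -
  have W: "removable {w}" using w by (auto simp: removable_def)
  have "w' \<in> S" using isolated_in_zero_forcing_set w'(1) S by blast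
  have wv: "w' \<in> verts G" "w' \<noteq> v" using w'(1) by (auto simp: isolated_def verts_H)
  have "white_neighbors G (S - {w}) w' = {v}"
  proof -
    have "w' \<rightarrow>\<^bsub>G\<^esub> y \<Longrightarrow> y = v" for y
      using w'(1) wv adj_H_sym[of w' y] by (auto simp: isolated_def adj_H_iff)
    then show ?thesis
      using wv adj_universal v_in_verts v_notin_zero_forcing_set[OF S]
      by (auto simp: white_neighbors_def)
  qed
  then have "color_change G (S - {w}) (insert v (S - {w}))"
    using \<open>w' \<in> S\<close> w'(2) by (intro color_change.force) auto
  with zero_forcing_set_insert_universal[OF W S] show ?thesis
    by (auto simp: zero_forcing_set_def intro: converse_rtranclp_into_rtranclp)
qed

text \<open>A smaller \<open>T\<close> also avoids \<open>v\<close>, and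
  \<open>T \<union> {w}\<close> is already a proper subset of \<open>S\<close>; hence both outcomes
  of \<open>zero_forcing_set_without_universal\<close> contradict minimality.\<close>

lemma minimal_zero_forcing_set_remove_isolated:
  assumes w: "isolated w" and w': "isolated w'" "w' \<noteq> w" and S: "minimal_zero_forcing_set H S"
  shows "minimal_zero_forcing_set G (S - {w})"
  unfolding minimal_zero_forcing_set_def
proof (intro conjI allI impI notI)
  have S': "zero_forcing_set H S" and least: "\<And>T. T \<subset> S \<Longrightarrow> \<not> zero_forcing_set H T"
    using S by (auto simp: minimal_zero_forcing_set_def)
  have W: "removable {w}" using w by (auto simp: removable_def)
  have wS: "w \<in> S" using removable_subset[OF W S'] by simp
  show "zero_forcing_set G (S - {w})"
    by (rule zero_forcing_set_remove_isolated[OF w w' S'])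
  fix T assume T: "T \<subset> S - {w}" and zT: "zero_forcing_set G T"
  then have vT: "v \<notin> T" and TW: "T \<inter> {w} = {}" using v_notin_zero_forcing_set[OF S'] by auto
  from zT W vT TW show False
  proof (cases rule: zero_forcing_set_without_universal)
    case (1 u)
    have "T \<union> {w} \<subset> S" using T wS by auto
    then show False using least 1 by blast
  next
    case (2 x)
    have "T - {x} \<union> {w} \<subset> S" using T wS by auto
    then show False using least 2 by blast
  qed
qed

section \<open>Case distinction on the number of isolated vertices\<close>

lemma upper_eq_zero_forcing_number_del_universal:
  assumes eq: "upper_zero_forcing_number G = zero_forcing_number G"
  shows "upper_zero_forcing_number H = zero_forcing_number H"
proof -
  have fin: "finite S" if "zero_forcing_set H S" for S
    using that finite_verts_H by (auto simp: zero_forcing_set_def intro: finite_subset)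
  note transfer = upper_eq_zero_forcing_number_transfer[OF finite_verts finite_verts_H eq]
  show ?thesis
  proof (cases "\<exists>w w'. isolated w \<and> isolated w' \<and> w' \<noteq> w")
    case True
    then obtain w w' where w: "isolated w" "isolated w'" "w' \<noteq> w" by blast
    have "card (S - {w}) + 1 = card S + 0" if "zero_forcing_set H S" for S
      using card_Suc_Diff1[OF fin[OF that] isolated_in_zero_forcing_set[OF w(1) that]] by simp
    with transfer[of "\<lambda>S. S - {w}"] zero_forcing_set_remove_isolated[OF w]
      minimal_zero_forcing_set_remove_isolated[OF w] show ?thesis by blast
  next
    case False
    define W where "W = Collect isolated"
    \<comment> \<open>With at most one isolated vertex, the set of all of them is removable.\<close>
    have "W = {} \<or> (\<exists>w. W = {w})" using False unfolding W_def by blast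
    then have W: "removable W" "finite W" 
      unfolding removable_def by (auto simp: W_def[symmetric]) (auto simp: W_def)
    have only: "isolated w \<Longrightarrow> w \<in> W" for w by (simp add: W_def)
    \<comment> \<open>\<open>v\<close> comes in and \<open>W\<close> goes out: the size grows by one
      if \<open>W\<close> is empty and is unchanged if \<open>W\<close> is a singleton, whatever
      \<open>S\<close> is.\<close>
    have "card (insert v (S - W)) + card W = card S + 1" if "zero_forcing_set H S" for S
      using removable_subset[OF W(1) that] v_notin_zero_forcing_set[OF that] fin[OF that] W(2)
      by (simp add: card_Diff_subset card_mono)
    with transfer[of "\<lambda>S. insert v (S - W)"] zero_forcing_set_insert_universal[OF W(1)]
      minimal_zero_forcing_set_insert_universal[OF W(1) only] show ?thesis by blast
  qed
qed

end

theorem theorem3p6: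
  fixes G :: "('a, 'b) pre_digraph" and v :: 'a
  assumes "graph G"
    and "universal_vertex G v"
    and "upper_zero_forcing_number G = zero_forcing_number G"
  shows "upper_zero_forcing_number (pre_digraph.del_vert G v)
       = zero_forcing_number (pre_digraph.del_vert G v)"
proof -
  interpret graph_with_universal_vertex G v
    using assms by (simp add: graph_with_universal_vertex_def graph_with_universal_vertex_axioms_def)
  show ?thesis using assms(3) by (rule upper_eq_zero_forcing_number_del_universal)
qed

end
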